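(* Let $n\geq 40$ be an integer. Then $$ex_{ori}(n,\overrightarrow{S_{3,1}})=\left\lfloor\frac{(n+2)^2}{4}\right\rfloor.$$ Moreover, an oriented graph $D$ of order $n$ is $\overrightarrow{S_{3,1}}$-free with exactly $ex_{ori}(n,\overrightarrow{S_{3,1}})$ arcs if and only if $V(D)$ has a partition $V(D)=X\cup Y$ such that (i) $|X|\in\{\lfloor n/2\rfloor-1,\lceil n/2\rceil-1\}$; (ii) $xy\in A(D)$ for all $x\in X$, $y\in Y$; (iii) $D[X]$ has no arcs, and $D[Y]$ is an in-degree $2$-regular digraph (every vertex of $D[Y]$ has in-degree exactly $2$ in $D[Y]$).
   Context: An oriented graph is a digraph obtained from a finite simple undirected graph by choosing an orientation for each edge (so no loops, and at most one arc between any two vertices). For a digraph $F$, $D$ is $F$-free if it contains no subgraph isomorphic to $F$. The oriented Turán number $ex_{ori}(n,F)$ is the maximum number of arcs in an $F$-free oriented graph on $n$ vertices. For a positive integer $k$, $\overrightarrow{S_{k,1}}$ is the $1$-subdivision of the in-star with $k$ leaves: it has vertices $v$ (the center), $w_1,\dots,w_k$, $z_1,\dots,z_k$, and arcs $z_iw_i$ and $w_iv$ for $i=1,\dots,k$. $D[X]$ denotes the subdigraph induced by $X$. *)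

theory Defs
  imports "Graph_Theory.Graph_Theory"
begin

locale oriented_graph = pair_digraph +
  assumes no_opposite_arcs: "(u, v) \<in> parcs G \<Longrightarrow> (v, u) \<notin> parcs G"

(* "Subgraph" here is not necessarily induced. *)
definition digraph_free :: "'b pair_pre_digraph \<Rightarrow> 'a pair_pre_digraph \<Rightarrow> bool" where
  "digraph_free F D \<longleftrightarrow>
     \<not> (\<exists>H :: 'a pair_pre_digraph.
           subgraph (with_proj H) (with_proj D) \<and> digraph_iso (with_proj F) (with_proj H))"

(* Every finite digraph is isomorphic to one with vertices in nat, so restricting
   the vertex type to nat loses nothing.  The set is bounded by n^2, hence finite; it is
   nonempty, so that Max is meaningful, as soon as F has at least one arc. *)
definition ex_ori :: "nat \<Rightarrow> 'b pair_pre_digraph \<Rightarrow> nat" where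
  "ex_ori n F =
     Max {card (parcs D) | D :: nat pair_pre_digraph.
            oriented_graph D \<and> card (pverts D) = n \<and> digraph_free F D}"

datatype star_vertex = Center | Mid nat | Leaf nat

(* Center, Mid i, Leaf i stand for v, w_i, z_i. *)
definition subdivided_in_star :: "nat \<Rightarrow> star_vertex pair_pre_digraph" where
  "subdivided_in_star k =
     \<lparr> pverts = {Center} \<union> Mid ` {1..k} \<union> Leaf ` {1..k},
       parcs = {(Leaf i, Mid i) | i. i \<in> {1..k}} \<union> {(Mid i, Center) | i. i \<in> {1..k}} \<rparr>"

definition in_degree_regular :: "nat \<Rightarrow> ('a, 'b) pre_digraph \<Rightarrow> bool" where
  "in_degree_regular d G \<longleftrightarrow> (\<forall>v \<in> verts G. in_degree G v = d)"

end

theory Submission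
  imports Defs
begin

text \<open>
  No vertex has three in-neighbours of in-degree at least five, since these could be matched greedily.
  Let \<open>v\<close> have maximum in-degree \<open>d\<close> and let \<open>N\<close> be its in-neighbourhood. The arcs with head in \<open>N\<close>
  contain no three disjoint ones, and at most \<open>d (n - d)\<close> arcs have their head outside \<open>N\<close>; so if there
  are about \<open>(n + 2)\<^sup>2 / 4\<close> arcs, then more than \<open>n\<close> of them enter \<open>N\<close>, and these are covered by two
  vertices, the hubs \<open>h\<close> and \<open>h'\<close> (one vertex and a triangle would give too few arcs).

  Put \<open>S = N - {h, h'}\<close> and \<open>R = V - S\<close>. Only the hubs send arcs into \<open>S\<close>, and every in-degree is at
  most \<open>card S + 2\<close>. Counting the arcs between a hub and \<open>S\<close> at the hub, whichever way they point,
  bounds the number of arcs by \<open>(card S + 2) * card R\<close> as soon as the two hubs together exceed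
  \<open>2 * card S\<close> by at most four. A hub can do better only with in-neighbours in \<open>R\<close> of small in-degree,
  which is costly, and an arc from a hub into \<open>S\<close> prevents each in-neighbour of that hub from
  having full in-degree. Hence in the case of equality \<open>S\<close> receives no arcs, \<open>S\<close> is completely
  joined to \<open>R\<close>, and every vertex of \<open>R\<close> has exactly two in-neighbours in \<open>R\<close>.
\<close>

text \<open>Pairwise meeting edges form a star or a triangle. Without opposite arcs, distinct arcs
  have distinct underlying pairs, so a triangle carries at most three arcs.\<close>

lemma intersecting_arcs:
  fixes E :: "('a \<times> 'a) set"
  assumes meet: "\<And>a b c d. (a, b) \<in> E \<Longrightarrow> (c, d) \<in> E \<Longrightarrow> {a, b} \<inter> {c, d} \<noteq> {}"
    and loopfree: "\<And>a. (a, a) \<notin> E"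
    and oriented: "\<And>a b. (a, b) \<in> E \<Longrightarrow> (b, a) \<notin> E"
  shows "(\<exists>c. \<forall>(a, b) \<in> E. c \<in> {a, b}) \<or> card E \<le> 3"
proof (rule disjCI)
  assume "\<not> card E \<le> 3"
  then have large: "3 < card E" by simp
  show "\<exists>c. \<forall>(a, b) \<in> E. c \<in> {a, b}"
  proof (rule ccontr)
    assume no_common: "\<not> (\<exists>c. \<forall>(a, b) \<in> E. c \<in> {a, b})"
    let ?e = "\<lambda>(x, y). {x, y}"
    have inj: "inj_on ?e E"
      using oriented by (auto simp: inj_on_def doubleton_eq_iff)
    from large have "E \<noteq> {}" by auto
    then obtain a b where ab: "(a, b) \<in> E" by auto
    then have "a \<noteq> b" using loopfree by auto
    have avoid: "\<exists>x y. (x, y) \<in> E \<and> c \<noteq> x \<and> c \<noteq> y" for c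
    proof -
      have "\<not> (\<forall>(x, y) \<in> E. c \<in> {x, y})" using no_common by (rule contrapos_nn) (rule exI)
      then show ?thesis by auto
    qed
    \<comment> \<open>An arc avoiding \<open>a\<close> must meet the first arc in \<open>b\<close>;
      it produces the third corner \<open>c\<close> of the triangle. An arc avoiding
      \<open>b\<close> then has to be the side between \<open>a\<close> and
      \<open>c\<close>.\<close>
    obtain x y where e2: "(x, y) \<in> E" "a \<noteq> x" "a \<noteq> y" using avoid[of a] by auto
    have "x \<noteq> y" using e2 loopfree by auto
    then obtain c where c: "{x, y} = {b, c}" "c \<noteq> a" "c \<noteq> b"
      using e2 meet[OF ab e2(1)] that[of x] that[of y] by (auto simp: doubleton_eq_iff)
    obtain x' y' where e3: "(x', y') \<in> E" "b \<noteq> x'" "b \<noteq> y'" using avoid[of b] by auto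
    have e3c: "{x', y'} = {a, c}"
      using e3 c(2,3) meet[OF ab e3(1)] meet[OF e2(1) e3(1)] unfolding c(1) by auto
    have "?e e \<in> {{a, b}, {b, c}, {a, c}}" if "e \<in> E" for e
    proof -
      obtain p q where e: "e = (p, q)" by (cases e)
      then have pq: "(p, q) \<in> E" using that by simp
      have "p \<noteq> q" using pq loopfree by auto
      moreover note meet[OF ab pq] meet[OF e2(1) pq, unfolded c(1)] meet[OF e3(1) pq, unfolded e3c]
      ultimately have "{p, q} = {a, b} \<or> {p, q} = {b, c} \<or> {p, q} = {a, c}"
        using c(2,3) \<open>a \<noteq> b\<close> by auto
      then show ?thesis using e by simp
    qed
    then have "?e ` E \<subseteq> {{a, b}, {b, c}, {a, c}}" by (rule image_subsetI)
    then have "card (?e ` E) \<le> card {{a, b}, {b, c}, {a, c}}" by (intro card_mono) auto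
    also have "\<dots> \<le> 3" by (auto simp: card_insert_if)
    finally show False using large card_image[OF inj] by simp
  qed
qed

lemma four_mult_le_square: "4 * (a * b) \<le> (a + b)\<^sup>2" for a b :: nat
proof -
  have "0 \<le> (int a - int b)\<^sup>2" by simp
  then have "int (4 * (a * b)) \<le> int ((a + b)\<^sup>2)" by (simp add: power2_eq_square algebra_simps)
  then show ?thesis by linarith
qed

section \<open>Vertices of large in-degree\<close>

context oriented_graph
begin

abbreviation "V \<equiv> pverts G"
abbreviation "A \<equiv> parcs G"

definition In :: "'a \<Rightarrow> 'a set" where
  "In y = {x. (x, y) \<in> A}"

definition indeg :: "'a \<Rightarrow> nat" where
  "indeg y = card (In y)"

text \<open>The threshold is five because a middle vertex of the star has to find a leaf outside the
  four vertices of the other two branches.\<close>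

definition Big :: "'a set" where
  "Big = {y \<in> V. 5 \<le> indeg y}"

lemma In_iff: "x \<in> In y \<longleftrightarrow> (x, y) \<in> A"
  by (simp add: In_def)

lemma In_subset: "In y \<subseteq> V"
  by (auto simp: In_def dest: in_arcsD1)

lemma finite_In [simp]: "finite (In y)"
  using In_subset pair_finite_verts finite_subset by blast

lemma not_loop: "(x, x) \<notin> A"
  using pair_no_loops by fastforce

lemma finite_Big [simp]: "finite Big"
  using pair_finite_verts by (simp add: Big_def)

lemma card_arcs: "card A = (\<Sum>y\<in>V. indeg y)"
proof -
  have "A = (\<Union>y\<in>V. (\<lambda>x. (x, y)) ` In y)"
    by (auto simp: In_def dest: in_arcsD2)
  also have "card \<dots> = (\<Sum>y\<in>V. card ((\<lambda>x. (x, y)) ` In y))"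
    using pair_finite_verts by (intro card_UN_disjoint) auto
  also have "\<dots> = (\<Sum>y\<in>V. indeg y)"
    by (intro sum.cong refl) (simp add: indeg_def card_image inj_on_def)
  finally show ?thesis .
qed

end

text \<open>The centre is missing from the distinctness list: if it were some \<open>w\<close>,
  there would be a loop, and if it were some \<open>z\<close>, there would be a pair of opposite
  arcs.\<close>

locale star3_free = oriented_graph +
  assumes no_star: "\<lbrakk>(w1, c) \<in> parcs G; (w2, c) \<in> parcs G; (w3, c) \<in> parcs G;
    (z1, w1) \<in> parcs G; (z2, w2) \<in> parcs G; (z3, w3) \<in> parcs G;
    distinct [w1, w2, w3, z1, z2, z3]\<rbrakk> \<Longrightarrow> False"
begin

lemma big_In_avoid:
  assumes "x \<in> Big" "finite F" "card F \<le> 4"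
  obtains z where "(z, x) \<in> A" "z \<notin> F" "z \<noteq> x"
proof -
  have "card F < card (In x)" using assms by (simp add: Big_def indeg_def)
  then obtain z where "z \<in> In x" "z \<notin> F"
    by (meson assms(2) card_mono leD subsetI)
  then show thesis using that not_loop by (auto simp: In_iff)
qed

text \<open>Vertices of in-degree at least five can always be matched to a private in-neighbour, after the
  remaining four vertices of the star have been chosen.\<close>

lemma one_big_in:
  assumes "x \<in> Big" "(x, y) \<in> A" "(w1, y) \<in> A" "(w2, y) \<in> A" "(z1, w1) \<in> A" "(z2, w2) \<in> A"
    and "distinct [x, w1, w2, z1, z2]"
  shows False
proof -
  obtain z where "(z, x) \<in> A" "z \<notin> {w1, w2, z1, z2}" "z \<noteq> x"
    using big_In_avoid[OF assms(1), of "{w1, w2, z1, z2}"] card_length[of "[w1, w2, z1, z2]"] by auto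
  then show False
    using no_star[of x y w1 w2 z z1 z2] assms by auto
qed

lemma two_big_in:
  assumes "x \<in> Big" "x' \<in> Big" "(x, y) \<in> A" "(x', y) \<in> A" "(w, y) \<in> A" "(z, w) \<in> A"
    and "distinct [x, x', w, z]"
  shows False
proof -
  obtain z' where "(z', x') \<in> A" "z' \<notin> {x, w, z}" "z' \<noteq> x'"
    using big_In_avoid[OF assms(2), of "{x, w, z}"] card_length[of "[x, w, z]"] by auto
  then show False
    using one_big_in[of x y x' w z' z] assms by auto
qed

text \<open>This is where the in-degree two of the extremal structure comes from: \<open>R\<close>
  will turn out to be exactly \<open>Big\<close>.\<close>

lemma card_In_Big: "card (In y \<inter> Big) \<le> 2"
proof (rule ccontr)
  assume "\<not> ?thesis"
  then obtain B where "B \<subseteq> In y \<inter> Big" "card B = 3"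
    by (metis not_less_eq_eq numeral_2_eq_2 numeral_3_eq_3 obtain_subset_with_card_n)
  then obtain x x' w where x: "x \<in> Big" "x' \<in> Big" "w \<in> Big" "(x, y) \<in> A" "(x', y) \<in> A" "(w, y) \<in> A"
    "distinct [x, x', w]"
    by (auto simp: card_3_iff In_iff)
  obtain z where "(z, w) \<in> A" "z \<notin> {x, x'}" "z \<noteq> w"
    using big_In_avoid[OF x(3), of "{x, x'}"] card_length[of "[x, x']"] by auto
  then show False using two_big_in[of x x' y w z] x by auto
qed

end

section \<open>Two hubs\<close>

text \<open>\<open>S\<close> plays the role of \<open>X\<close> in the extremal partition. By
  \<open>many_arcs\<close> there are at least as many arcs as in an extremal digraph with this
  \<open>X\<close>, so every estimate below has almost no slack.\<close>

locale hub_pair = star3_free +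
  fixes S :: "'a set" and h h' :: 'a
  assumes S_subset: "S \<subseteq> V"
    and hubs: "h \<in> V - S" "h' \<in> V - S" "h \<noteq> h'"
    and into_S: "(z, w) \<in> A \<Longrightarrow> w \<in> S \<Longrightarrow> z \<in> {h, h'}"
    and indeg_le: "y \<in> V \<Longrightarrow> indeg y \<le> card S + 2"
    and card_S: "6 \<le> card S"
    and many_arcs: "(card S + 2) * card (V - S) \<le> card A"
begin

definition R :: "'a set" where "R = V - S"
definition M :: "'a set" where "M = R - {h, h'}"
definition Out :: "'a \<Rightarrow> 'a set" where "Out x = {w \<in> S. (x, w) \<in> A}"

text \<open>The assumptions are symmetric in the hubs, so each result about one hub transfers to the
  other.\<close>

lemma swap: "hub_pair G S h' h"
  using S_subset hubs into_S indeg_le card_S many_arcs by unfold_locales auto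

lemma swap_M: "hub_pair.M G S h' h = M"
  unfolding M_def hub_pair.M_def[OF swap] by auto

lemma finite_parts [simp]: "finite V" "finite S" "finite R" "finite M" "finite (Out x)"
  using pair_finite_verts S_subset finite_subset[OF S_subset]
  by (auto simp: R_def M_def Out_def)

lemma card_R: "card R = card M + 2"
proof -
  have "R = insert h (insert h' M)" "h \<notin> M" "h' \<notin> M" using hubs by (auto simp: R_def M_def)
  then show ?thesis using hubs by simp
qed

lemma indeg_split: "indeg y = card (In y \<inter> S) + card (In y \<inter> R)"
proof -
  have "In y = (In y \<inter> S) \<union> (In y \<inter> R)" using In_subset by (auto simp: R_def)
  then show ?thesis unfolding indeg_def
    by (metis (no_types, lifting) Diff_disjoint R_def card_Un_disjoint finite_In finite_Int inf_assoc inf_bot_right inf_commute)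
qed

lemma sum_S: "(\<Sum>w\<in>S. indeg w) = card (Out h) + card (Out h')"
proof -
  have "indeg w = (if (h, w) \<in> A then 1 else 0) + (if (h', w) \<in> A then 1 else 0)" if "w \<in> S" for w
  proof -
    have "In w = (if (h, w) \<in> A then {h} else {}) \<union> (if (h', w) \<in> A then {h'} else {})"
      using into_S that by (auto simp: In_def)
    then show ?thesis using hubs by (simp add: indeg_def)
  qed
  then have "(\<Sum>w\<in>S. indeg w) = (\<Sum>w\<in>S. (if (h, w) \<in> A then 1 else 0) + (if (h', w) \<in> A then 1 else 0))"
    by (intro sum.cong) auto
  also have "\<dots> = card (Out h) + card (Out h')"
    by (simp add: sum.distrib sum.If_cases Out_def Int_def conj_commute)
  finally show ?thesis .
qed

text \<open>Arcs into \<open>S\<close> all start at hubs and are charged to the hub they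
  leave.\<close>

lemma card_arcs_split:
  "card A = (\<Sum>y\<in>M. indeg y) + (indeg h + card (Out h)) + (indeg h' + card (Out h'))"
proof -
  have V: "V = S \<union> insert h (insert h' M)" using hubs S_subset by (auto simp: R_def M_def)
  have "(\<Sum>y\<in>V. indeg y) = (\<Sum>y\<in>S. indeg y) + (\<Sum>y\<in>insert h (insert h' M). indeg y)"
    unfolding V using hubs by (intro sum.union_disjoint) (auto simp: M_def R_def)
  also have "(\<Sum>y\<in>insert h (insert h' M). indeg y) = indeg h + (indeg h' + (\<Sum>y\<in>M. indeg y))"
    using hubs by (simp add: M_def)
  finally show ?thesis using sum_S card_arcs by simp
qed

text \<open>Each vertex of \<open>S\<close> is joined to a hub by at most one arc, so it is irrelevant which way the
  arcs between the hubs and \<open>S\<close> point.\<close>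

lemma hub_degree_le: "indeg x + card (Out x) \<le> card S + card (In x \<inter> R)"
proof -
  have "card (In x \<inter> S) + card (Out x) = card ((In x \<inter> S) \<union> Out x)"
    using no_opposite_arcs by (intro card_Un_disjoint[symmetric]) (auto simp: In_def Out_def)
  also have "\<dots> \<le> card S" by (intro card_mono) (auto simp: Out_def)
  finally show ?thesis using indeg_split[of x] by linarith
qed

text \<open>Apart from at most two vertices of \<open>Big\<close>, only small vertices of
  \<open>M\<close> and the other hub can occur. The other hub gets its own term because it is not
  yet known to be big.\<close>

lemma card_In_R_le:
  "card (In h \<inter> R) \<le> 2 + card (M - Big) + (if (h', h) \<in> A then 1 else 0)"
proof -
  have "In h \<inter> R \<subseteq> (In h \<inter> Big) \<union> (M - Big) \<union> (if (h', h) \<in> A then {h'} else {})"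
    using not_loop by (auto simp: In_def M_def)
  then have "card (In h \<inter> R) \<le> card ((In h \<inter> Big) \<union> (M - Big) \<union> (if (h', h) \<in> A then {h'} else {}))"
    by (intro card_mono) auto
  also have "\<dots> \<le> card (In h \<inter> Big) + card (M - Big) + card (if (h', h) \<in> A then {h'} else {})"
    by (meson add_mono card_Un_le le_refl order_trans)
  finally show ?thesis using card_In_Big[of h] by (auto split: if_splits)
qed

lemma card_In_R_le': "card (In h' \<inter> R) \<le> 2 + card (M - Big) + (if (h, h') \<in> A then 1 else 0)"
  using hub_pair.card_In_R_le[OF swap] by (simp add: swap_M)

text \<open>Bookkeeping of deficits: each vertex of \<open>Q\<close> falls short of the largest
  possible in-degree by at least \<open>c\<close>.\<close>

lemma sum_M_le:
  assumes "Q \<subseteq> M" "\<And>y. y \<in> Q \<Longrightarrow> indeg y + c \<le> card S + 2"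
  shows "(\<Sum>y\<in>M. indeg y) + card Q * c \<le> card M * (card S + 2)"
proof -
  have "(\<Sum>y\<in>M. indeg y) + card Q * c = (\<Sum>y\<in>M. indeg y + (if y \<in> Q then c else 0))"
    using assms(1) by (simp add: sum.distrib sum.If_cases Int_absorb1 Int_absorb2)
  also have "\<dots> \<le> (\<Sum>y\<in>M. card S + 2)"
    using assms indeg_le by (intro sum_mono) (auto simp: M_def R_def)
  finally show ?thesis by simp
qed

lemma many_arcs': "card M * (card S + 2) + 2 * card S + 4 \<le> card A"
  using many_arcs card_R by (simp add: R_def algebra_simps)

text \<open>A small vertex of \<open>M\<close> costs at least \<open>card S - 2\<close> in the sum
  over \<open>M\<close>, but raises the bounds for the two hubs by only one each. With
  \<open>card S\<close> at least six this does not pay.\<close>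

lemma M_subset_Big: "M \<subseteq> Big"
proof -
  let ?q = "card (M - Big)"
  \<comment> \<open>The hubs are joined by at most one arc, so the extra unit in the two hub bounds
    arises only once.\<close>
  have opp: "(if (h', h) \<in> A then 1 else 0) + (if (h, h') \<in> A then 1 else 0) \<le> (1::nat)"
    using no_opposite_arcs by auto
  have "(\<Sum>y\<in>M. indeg y) + ?q * (card S - 2) \<le> card M * (card S + 2)"
    using card_S by (intro sum_M_le) (auto simp: Big_def M_def R_def)
  then have "?q * (card S - 2) \<le> 1 + 2 * ?q"
    using many_arcs' card_arcs_split hub_degree_le[of h] hub_degree_le[of h'] card_In_R_le card_In_R_le' opp
    by linarith
  moreover have "?q * 4 \<le> ?q * (card S - 2)" using card_S by (intro mult_le_mono) auto
  ultimately have "?q = 0" by linarith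
  then show ?thesis by auto
qed

lemma In_R_le: "card (In h \<inter> R) \<le> 2 + (if (h', h) \<in> A then 1 else 0)"
    and In_R_le': "card (In h' \<inter> R) \<le> 2 + (if (h, h') \<in> A then 1 else 0)"
proof -
  have "M - Big = {}" using M_subset_Big by auto
  then have "card (M - Big) = 0" by simp
  then show "card (In h \<inter> R) \<le> 2 + (if (h', h) \<in> A then 1 else 0)"
    "card (In h' \<inter> R) \<le> 2 + (if (h, h') \<in> A then 1 else 0)"
    using card_In_R_le card_In_R_le' by linarith+
qed

text \<open>If every in-neighbour of \<open>h\<close> in \<open>M\<close> had a deficit, the total
  deficit would cancel what these vertices contribute to the in-degree of \<open>h\<close>, and the
  count would fall one short of \<open>many_arcs\<close>.\<close>

lemma exists_full_in_neighbour:
  "\<exists>p \<in> M. (p, h) \<in> A \<and> indeg p = card S + 2"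
proof (rule ccontr)
  assume none: "\<not> ?thesis"
  let ?P = "In h \<inter> M"
  have opp: "(if (h', h) \<in> A then 1 else 0) + (if (h, h') \<in> A then 1 else 0) \<le> (1::nat)"
    using no_opposite_arcs by auto
  have "indeg y + 1 \<le> card S + 2" if "y \<in> ?P" for y
    using none that indeg_le[of y] by (force simp: In_def M_def R_def)
  then have "(\<Sum>y\<in>M. indeg y) + card ?P * 1 \<le> card M * (card S + 2)"
    by (intro sum_M_le) auto
  moreover have "card (In h \<inter> R) \<le> card ?P + (if (h', h) \<in> A then 1 else 0)"
  proof -
    have "In h \<inter> R \<subseteq> ?P \<union> (if (h', h) \<in> A then {h'} else {})"
      using not_loop by (auto simp: In_def M_def)
    then have "card (In h \<inter> R) \<le> card (?P \<union> (if (h', h) \<in> A then {h'} else {}))"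
      by (intro card_mono) auto
    also have "\<dots> \<le> card ?P + card (if (h', h) \<in> A then {h'} else {})" by (rule card_Un_le)
    finally show ?thesis by (auto split: if_splits)
  qed
  ultimately show False
    using many_arcs' card_arcs_split hub_degree_le[of h] hub_degree_le[of h'] In_R_le' opp
    by linarith
qed

text \<open>The hub \<open>h\<close> contributes at most \<open>card S + 3\<close> to the arc count,
  which leaves this much for \<open>h'\<close>.\<close>

lemma hub_degree_ge: "card S + 1 \<le> indeg h' + card (Out h')"
proof -
  have "(\<Sum>y\<in>M. indeg y) \<le> card M * (card S + 2)" using sum_M_le[of "{}" 0] by simp
  moreover have "card (In h \<inter> R) \<le> 3" using In_R_le by (auto split: if_splits)
  ultimately show ?thesis
    using many_arcs' card_arcs_split hub_degree_le[of h] by linarith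
qed

lemma Big_R: "x \<in> Big \<Longrightarrow> x \<in> R"
proof (rule ccontr)
  assume x: "x \<in> Big" "x \<notin> R"
  then have "x \<in> S" by (auto simp: Big_def R_def)
  then have "In x \<subseteq> {h, h'}" using into_S by (auto simp: In_def)
  then have "card (In x) \<le> card {h, h'}" by (intro card_mono) auto
  also have "\<dots> \<le> 2" by (simp add: card_insert_if)
  finally show False using x by (simp add: Big_def indeg_def)
qed

text \<open>The vertex \<open>h\<close> serves as the leaf of \<open>w\<close> in a star centred at
  \<open>p\<close>. The arc from \<open>p\<close> to \<open>h\<close> guarantees that
  \<open>h\<close> is neither \<open>x\<close> nor \<open>x'\<close>.\<close>

lemma two_big_false:
  assumes "x \<in> In p \<inter> Big" "x' \<in> In p \<inter> Big" "x \<noteq> x'" "w \<in> Out h" "w \<in> In p" "(p, h) \<in> A"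
  shows False
proof (rule two_big_in[of x x' p w h])
  show "distinct [x, x', w, h]"
    using assms Big_R[of x] Big_R[of x'] no_opposite_arcs hubs
    by (auto simp: Out_def In_def R_def)
qed (use assms in \<open>auto simp: In_def Out_def\<close>)

lemma obtain_two_big:
  assumes "2 \<le> card (In p \<inter> Big)"
  obtains x x' where "x \<in> In p \<inter> Big" "x' \<in> In p \<inter> Big" "x \<noteq> x'"
proof -
  obtain B where "B \<subseteq> In p \<inter> Big" "card B = 2" using assms obtain_subset_with_card_n by metis
  then show thesis using that by (auto simp: card_2_iff)
qed

lemma card_Out_le_1: "card (Out h) \<le> 1"
proof (rule ccontr)
  assume two: "\<not> ?thesis"
  obtain p where p: "p \<in> M" "(p, h) \<in> A" "indeg p = card S + 2"
    using exists_full_in_neighbour by blast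
  have "(h, p) \<notin> A" using p no_opposite_arcs by blast
  \<comment> \<open>As \<open>h\<close> is not an in-neighbour of \<open>p\<close>, the only
    possibly small in-neighbour of \<open>p\<close> in \<open>R\<close> is
    \<open>h'\<close>.\<close>
  then have InR: "In p \<inter> R \<subseteq> insert h' (In p \<inter> Big)"
    using M_subset_Big by (auto simp: In_def M_def)
  show False
  proof (cases "2 \<le> card (In p \<inter> Big)")
    case True
    then obtain x x' where x: "x \<in> In p \<inter> Big" "x' \<in> In p \<inter> Big" "x \<noteq> x'"
      by (rule obtain_two_big)
    have "card (In p \<inter> R) \<le> card (insert h' (In p \<inter> Big))"
      using InR by (intro card_mono) auto
    also have "\<dots> \<le> 3" using card_In_Big[of p] by (simp add: card_insert_if)
    finally have "card S \<le> card (In p \<inter> S) + 1" using indeg_split[of p] p by linarith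
    moreover have "card (S - In p) = card S - card (In p \<inter> S)"
      by (simp add: card_Diff_subset_Int Int_commute)
    \<comment> \<open>At least one of the two or more vertices of \<open>Out h\<close> is therefore
      an in-neighbour of \<open>p\<close>.\<close>
    ultimately have miss: "card (S - In p) \<le> 1" by linarith
    have "\<not> Out h \<subseteq> S - In p"
    proof
      assume "Out h \<subseteq> S - In p"
      then have "card (Out h) \<le> card (S - In p)" by (intro card_mono) auto
      then show False using two miss by linarith
    qed
    then obtain w where "w \<in> Out h" "w \<in> In p" by (auto simp: Out_def)
    then show False using two_big_false x p by blast
  next
    case False
    have "card S + 2 \<le> card (In p \<inter> S) + card (In p \<inter> R)" using p indeg_split by simp
    moreover have "card (In p \<inter> S) \<le> card S" by (intro card_mono) auto
    moreover have "card (insert h' (In p \<inter> Big)) \<le> 2" using False by (simp add: card_insert_if)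
    moreover have "card (In p \<inter> R) \<le> card (insert h' (In p \<inter> Big))"
      using InR by (intro card_mono) auto
    ultimately have eq: "card (In p \<inter> S) = card S" "card (In p \<inter> R) = 2"
       "card (insert h' (In p \<inter> Big)) = 2"
      by linarith+
    have full: "S \<subseteq> In p" using eq(1) by (metis card_subset_eq finite_parts(2) inf_le1 inf_le2)
    have "h' \<notin> In p \<inter> Big" using eq(3) False by (auto simp: insert_absorb)
    moreover have InR_eq: "In p \<inter> R = insert h' (In p \<inter> Big)"
      using InR eq by (intro card_subset_eq) auto
    ultimately have h': "h' \<in> In p" "h' \<notin> Big" by auto
    have "card (In p \<inter> Big) = 1" using eq(3) h' by simp
    then obtain x where x: "x \<in> In p" "x \<in> Big"
      by (metis card_1_singletonE IntE insertI1)
    \<comment> \<open>A small \<open>h'\<close> can reach the total required by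
      \<open>hub_degree_ge\<close> only by sending arcs into \<open>S\<close>.\<close>
    have "indeg h' \<le> 4" using h' hubs by (auto simp: Big_def)
    then have "0 < card (Out h')" using hub_degree_ge card_S by linarith
    then obtain w' where w': "w' \<in> Out h'" by (metis card_gt_0_iff ex_in_conv)
    have "\<not> Out h \<subseteq> {w'}" using two card_mono[of "{w'}" "Out h"] by auto
    then obtain w where w: "w \<in> Out h" "w \<noteq> w'" by auto
    \<comment> \<open>The branches at \<open>p\<close> are \<open>w\<close> with leaf
      \<open>h\<close>, \<open>w'\<close> with leaf \<open>h'\<close>, and the big vertex
      \<open>x\<close>. Two vertices in \<open>Out h\<close> were needed to choose \<open>w\<close>
      different from \<open>w'\<close>.\<close>
    show False
    proof (rule one_big_in[of x p w w' h h'])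
      show "distinct [x, w, w', h, h']"
        using x w w' hubs h' Big_R[of x] \<open>(h, p) \<notin> A\<close> by (auto simp: Out_def In_def R_def)
    qed (use x w w' full in \<open>auto simp: Out_def In_def\<close>)
  qed
qed

lemma hub'_Big: "h' \<in> Big"
proof -
  have "card (Out h') \<le> 1"
    using hub_pair.card_Out_le_1[OF swap] by (simp add: swap_M)
  then show ?thesis using hub_degree_ge card_S hubs by (auto simp: Big_def)
qed

lemma hub_Big: "h \<in> Big"
  using hub_pair.hub'_Big[OF swap] by (simp add: swap_M)

lemma R_eq_Big: "R = Big"
  using M_subset_Big hub_Big hub'_Big Big_R by (auto simp: M_def)

text \<open>Now that \<open>R\<close> is \<open>Big\<close>, a full in-neighbour \<open>p\<close> of
  \<open>h\<close> has two big in-neighbours and all of \<open>S\<close> as in-neighbours, so a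
  single vertex of \<open>Out h\<close> already completes a star.\<close>

lemma Out_empty: "Out h = {}"
proof (rule ccontr)
  assume "Out h \<noteq> {}"
  then obtain w where w: "w \<in> Out h" by auto
  obtain p where p: "p \<in> M" "(p, h) \<in> A" "indeg p = card S + 2"
    using exists_full_in_neighbour by blast
  have "card (In p \<inter> S) + card (In p \<inter> Big) = card S + 2"
    using indeg_split[of p] p R_eq_Big by simp
  moreover have "card (In p \<inter> S) \<le> card S" by (intro card_mono) auto
  ultimately have eq: "card (In p \<inter> S) = card S" "2 \<le> card (In p \<inter> Big)"
    using card_In_Big[of p] by linarith+
  then have "S \<subseteq> In p" by (metis card_subset_eq finite_parts(2) inf_le1 inf_le2)
  then have "w \<in> In p" using w by (auto simp: Out_def)
  moreover obtain x x' where "x \<in> In p \<inter> Big" "x' \<in> In p \<inter> Big" "x \<noteq> x'"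
    using eq(2) by (rule obtain_two_big)
  ultimately show False using two_big_false w p by blast
qed

lemma Out'_empty: "Out h' = {}"
  using hub_pair.Out_empty[OF swap] by (simp add: swap_M)

text \<open>Once \<open>S\<close> receives no arcs, all arcs are counted at \<open>R\<close>, and
  \<open>many_arcs\<close> forces every in-degree there to be \<open>card S + 2\<close>. At most
  \<open>card S\<close> of these arcs come from \<open>S\<close> and at most two from
  \<open>R\<close>, so both bounds are attained.\<close>

lemma extremal_structure:
  "(\<forall>x\<in>S. \<forall>y\<in>R. (x, y) \<in> A) \<and> (\<forall>w\<in>S. In w = {}) \<and> (\<forall>y\<in>R. card (In y \<inter> R) = 2)"
proof -
  have none: "In w = {}" if "w \<in> S" for w
    using that into_S Out_empty Out'_empty by (auto simp: In_def Out_def)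
  have "V = S \<union> R" "S \<inter> R = {}" using S_subset by (auto simp: R_def)
  then have "card A = (\<Sum>y\<in>S. indeg y) + (\<Sum>y\<in>R. indeg y)"
    using card_arcs sum.union_disjoint[of S R indeg] by simp
  also have "(\<Sum>y\<in>S. indeg y) = 0" using none by (simp add: indeg_def)
  finally have sumR: "(\<Sum>y\<in>R. card S + 2) \<le> (\<Sum>y\<in>R. indeg y)"
    using many_arcs by (simp add: R_def mult.commute)
  have full: "indeg y = card S + 2" if "y \<in> R" for y
  proof (rule ccontr)
    assume "indeg y \<noteq> card S + 2"
    then have "indeg y < card S + 2" using that indeg_le[of y] by (simp add: R_def)
    then have "(\<Sum>y\<in>R. indeg y) < (\<Sum>y\<in>R. card S + 2)"
      using that indeg_le by (intro sum_strict_mono_ex1) (auto simp: R_def)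
    then show False using sumR by linarith
  qed
  have eq: "card (In y \<inter> S) = card S \<and> card (In y \<inter> R) = 2" if "y \<in> R" for y
  proof -
    have "card (In y \<inter> S) \<le> card S" by (intro card_mono) auto
    then show ?thesis using full[OF that] indeg_split[of y] card_In_Big[of y] R_eq_Big by simp
  qed
  then have "S \<subseteq> In y" if "y \<in> R" for y
    using that by (metis card_subset_eq finite_parts(2) inf_le1 inf_le2)
  then show ?thesis using none eq by (auto simp: In_def)
qed

end

section \<open>Finding the hubs\<close>

context star3_free
begin

text \<open>These arcs are the possible branches of a star centred at \<open>v\<close>; three
  disjoint ones form a star.\<close>

definition Into :: "'a \<Rightarrow> ('a \<times> 'a) set" where
  "Into v = {(z, w) \<in> A. (w, v) \<in> A}"

definition incident :: "'a \<Rightarrow> 'a \<Rightarrow> ('a \<times> 'a) set" where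
  "incident v x = {(z, w) \<in> Into v. x = z \<or> x = w}"

definition other_end :: "'a \<Rightarrow> 'a \<times> 'a \<Rightarrow> 'a" where
  "other_end x = (\<lambda>(z, w). if z = x then w else z)"

lemma finite_Into [simp]: "finite (Into v)" "finite (incident v x)"
proof -
  have sub: "Into v \<subseteq> A" "incident v x \<subseteq> A" by (auto simp: Into_def incident_def)
  show "finite (Into v)" "finite (incident v x)"
    using sub pair_finite_arcs by (auto intro: finite_subset)
qed

lemma card_Into: "card (Into v) = (\<Sum>w\<in>In v. indeg w)"
proof -
  have "Into v = (\<Union>w\<in>In v. (\<lambda>z. (z, w)) ` In w)"
    by (auto simp: Into_def In_def)
  also have "card \<dots> = (\<Sum>w\<in>In v. card ((\<lambda>z. (z, w)) ` In w))"
    by (intro card_UN_disjoint) auto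
  also have "\<dots> = (\<Sum>w\<in>In v. indeg w)"
    by (intro sum.cong refl) (simp add: indeg_def card_image inj_on_def)
  finally show ?thesis .
qed

lemma no_three_disjoint:
  assumes "(z1, w1) \<in> Into v" "(z2, w2) \<in> Into v" "(z3, w3) \<in> Into v"
    and "{z1, w1} \<inter> {z2, w2} = {}" "{z1, w1} \<inter> {z3, w3} = {}" "{z2, w2} \<inter> {z3, w3} = {}"
  shows False
  using assms not_loop by (intro no_star[of w1 v w2 w3 z1 z2 z3]) (auto simp: Into_def)

text \<open>Two vertices carry at most one arc, so an arc at \<open>x\<close> is recovered from its
  other end.\<close>

lemma inj_on_other_end: "inj_on (other_end x) (incident v x)"
  using no_opposite_arcs
  by (auto simp: inj_on_def other_end_def incident_def Into_def split: if_splits)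

lemma incident_avoid:
  assumes "5 \<le> card (incident v x)" "finite F" "card F \<le> 4"
  obtains z w where "(z, w) \<in> Into v" "{z, w} \<inter> F \<subseteq> {x}"
proof -
  have "card F < card (other_end x ` incident v x)"
    using assms card_image[OF inj_on_other_end] by simp
  then have "\<not> other_end x ` incident v x \<subseteq> F"
    using card_mono[OF assms(2)] by (meson leD)
  then obtain e where "e \<in> incident v x" "other_end x e \<notin> F" by auto
  then have "(fst e, snd e) \<in> Into v" "{fst e, snd e} \<inter> F \<subseteq> {x}"
    by (auto simp: incident_def other_end_def split: if_splits)
  then show thesis by (rule that)
qed

text \<open>A vertex of large degree can be added to any two disjoint arcs avoiding it.\<close>

lemma avoiding_arcs_meet:
  assumes "5 \<le> card (incident v x)"
    and "(a, b) \<in> Into v - incident v x" "(c, d) \<in> Into v - incident v x"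
  shows "{a, b} \<inter> {c, d} \<noteq> {}"
proof
  assume disj: "{a, b} \<inter> {c, d} = {}"
  obtain z w where zw: "(z, w) \<in> Into v" "{z, w} \<inter> {a, b, c, d} \<subseteq> {x}"
    using incident_avoid[OF assms(1), of "{a, b, c, d}"] card_length[of "[a, b, c, d]"] by auto
  have "x \<notin> {a, b, c, d}" using assms(2,3) by (auto simp: incident_def)
  then show False
    using no_three_disjoint[of a b v c d z w] assms(2,3) zw disj by blast
qed

text \<open>Two disjoint branches, if they exist, meet every branch; otherwise a single one does. So
  at most four vertices cover \<open>Into v\<close>, and more than sixteen arcs put at least five on
  one of them.\<close>

lemma exists_large_incident:
  assumes "16 < card (Into v)"
  shows "\<exists>x\<in>V. 5 \<le> card (incident v x)"
proof -
  from assms have "Into v \<noteq> {}" by auto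
  then obtain a b where ab: "(a, b) \<in> Into v" by auto
  have "\<exists>c d. (c, d) \<in> Into v \<and> Into v \<subseteq> incident v a \<union> incident v b \<union> incident v c \<union> incident v d"
  proof (cases "\<exists>c d. (c, d) \<in> Into v \<and> {a, b} \<inter> {c, d} = {}")
    case True
    then obtain c d where cd: "(c, d) \<in> Into v" "{a, b} \<inter> {c, d} = {}" by auto
    have "Into v \<subseteq> incident v a \<union> incident v b \<union> incident v c \<union> incident v d"
    proof
      fix e assume "e \<in> Into v"
      then show "e \<in> incident v a \<union> incident v b \<union> incident v c \<union> incident v d"
        using no_three_disjoint[OF ab cd(1), of "fst e" "snd e"] cd(2)
        by (cases e) (auto simp: incident_def)
    qed
    with cd show ?thesis by blast
  next
    case False
    then have "Into v \<subseteq> incident v a \<union> incident v b \<union> incident v a \<union> incident v b"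
      by (auto simp: incident_def)
    then show ?thesis using ab by blast
  qed
  then obtain c d where cd: "(c, d) \<in> Into v"
    and sub: "Into v \<subseteq> incident v a \<union> incident v b \<union> incident v c \<union> incident v d"
    by blast
  have "card (Into v) \<le> card (incident v a \<union> incident v b \<union> incident v c \<union> incident v d)"
    using sub by (intro card_mono) auto
  also have "\<dots> \<le> card (incident v a) + card (incident v b) + card (incident v c) + card (incident v d)"
    by (meson add_mono card_Un_le le_refl order_trans)
  finally have "5 \<le> card (incident v a) \<or> 5 \<le> card (incident v b) \<or>
      5 \<le> card (incident v c) \<or> 5 \<le> card (incident v d)"
    using assms by linarith
  moreover have "{a, b, c, d} \<subseteq> V" using ab cd in_arcsD1 in_arcsD2 by (auto simp: Into_def)
  ultimately show ?thesis by blast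
qed

text \<open>The other end lies in \<open>In v\<close> if \<open>x\<close> is the tail. If
  \<open>x\<close> is the head, the other end is an in-neighbour of \<open>x\<close>, hence one of
  at most two big vertices unless it is small or in \<open>In v\<close>.\<close>

lemma card_incident_le: "card (incident v x) \<le> card (In v) + 2 + card (V - In v - Big)"
proof -
  have "card (incident v x) = card (other_end x ` incident v x)"
    using card_image[OF inj_on_other_end] by simp
  also have "other_end x ` incident v x \<subseteq> In v \<union> (In x \<inter> Big) \<union> (V - In v - Big)"
    by (auto simp: incident_def other_end_def Into_def In_def dest: in_arcsD1)
  then have "card (other_end x ` incident v x) \<le> card (In v \<union> (In x \<inter> Big) \<union> (V - In v - Big))"
    using pair_finite_verts by (intro card_mono) auto
  also have "\<dots> \<le> card (In v) + card (In x \<inter> Big) + card (V - In v - Big)"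
    by (meson add_mono card_Un_le le_refl order_trans)
  finally show ?thesis using card_In_Big[of x] by linarith
qed

text \<open>The density hypothesis says that there are at least
  \<open>(card V + 2)\<^sup>2 div 4\<close> arcs, since a square is 0 or 1 modulo 4.\<close>

lemma hub_pair_exists:
  assumes n: "40 \<le> card V" and dense: "(card V + 2)\<^sup>2 \<le> 4 * card A + 1"
  shows "\<exists>S h h'. hub_pair G S h h'"
proof -
  let ?n = "card V"
  have fin: "finite V" by (rule pair_finite_verts)
  have "V \<noteq> {}" using n by auto
  then have "Max (indeg ` V) \<in> indeg ` V" using fin by (intro Max_in) auto
  then obtain v where v: "v \<in> V" "Max (indeg ` V) = indeg v" by auto
  define N where "N = In v"
  define d where "d = card N"
  have N: "N \<subseteq> V" "finite N" using In_subset by (auto simp: N_def)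
  have le_d: "indeg y \<le> d" if "y \<in> V" for y
  proof -
    have "indeg y \<le> Max (indeg ` V)" using fin that by simp
    then show ?thesis using v by (simp add: d_def N_def indeg_def)
  qed
  have d_le: "d \<le> ?n" using N fin by (auto simp: d_def intro: card_mono)
  have sq: "(?n + 2)\<^sup>2 = ?n * ?n + 4 * ?n + 4" by (simp add: power2_eq_square algebra_simps)
  \<comment> \<open>In-degrees of at most 11 would give \<open>(n + 2)\<^sup>2\<close> at most
    \<open>44 * n + 1\<close>, which fails from \<open>n = 40\<close> on.\<close>
  have d12: "12 \<le> d"
  proof (rule ccontr)
    assume "\<not> ?thesis"
    then have "card A \<le> (\<Sum>y\<in>V. 11)" unfolding card_arcs using le_d by (intro sum_mono) force
    then have "card A \<le> 11 * ?n" by simp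
    moreover have "40 * ?n \<le> ?n * ?n" using n by simp
    ultimately show False using dense sq by linarith
  qed
  have split: "card A = card (Into v) + (\<Sum>y\<in>V - N. indeg y)"
    using sum.subset_diff[OF N(1) fin, of indeg] by (simp add: card_arcs card_Into N_def)
  have cardVN: "card (V - N) = ?n - d" using N by (simp add: d_def card_Diff_subset)
  \<comment> \<open>The deficit \<open>d - 4\<close> of each small vertex outside \<open>N\<close>
    will pay for the last term of \<open>card_incident_le\<close>.\<close>
  have outside: "(\<Sum>y\<in>V - N. indeg y) + card (V - N - Big) * (d - 4) \<le> (?n - d) * d"
  proof -
    have "(\<Sum>y\<in>V - N. indeg y) + card (V - N - Big) * (d - 4)
        = (\<Sum>y\<in>V - N. indeg y + (if y \<notin> Big then d - 4 else 0))"
      using fin by (simp add: sum.distrib sum.If_cases Diff_eq Int_assoc Collect_neg_eq)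
    also have "\<dots> \<le> (\<Sum>y\<in>V - N. d)"
      using le_d d12 by (intro sum_mono) (auto simp: Big_def)
    finally show ?thesis using cardVN by simp
  qed
  have "4 * (d * (?n - d)) \<le> (d + (?n - d))\<^sup>2" by (rule four_mult_le_square)
  then have prod: "4 * ((?n - d) * d) \<le> ?n * ?n" using d_le by (simp add: power2_eq_square mult.commute)
  \<comment> \<open>The arcs with head outside \<open>N\<close> number at most a quarter of
    \<open>n * n\<close>, so more than \<open>n\<close> arcs remain.\<close>
  have "16 < card (Into v)" using split outside prod dense sq n by linarith
  then obtain h where h: "h \<in> V" "5 \<le> card (incident v h)" using exists_large_incident by blast
  let ?E = "Into v - incident v h"
  have "(\<exists>c. \<forall>(a, b) \<in> ?E. c \<in> {a, b}) \<or> card ?E \<le> 3"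
    using avoiding_arcs_meet[OF h(2)] not_loop no_opposite_arcs
    by (intro intersecting_arcs) (auto simp: Into_def)
  then show ?thesis
  proof
    \<comment> \<open>In the triangle case the count is bounded by
      \<open>d * (n - d + 1) + 5\<close>. These factors add up to \<open>n + 1\<close> instead of
      \<open>n + 2\<close>, which is too small.\<close>
    assume "card ?E \<le> 3"
    moreover have "card (Into v) = card ?E + card (incident v h)"
    proof -
      have "incident v h \<subseteq> Into v" by (auto simp: incident_def)
      then show ?thesis by (simp add: card_Diff_subset card_mono)
    qed
    ultimately have "card (Into v) \<le> d + 5 + card (V - N - Big)"
      using card_incident_le[of v h] by (simp add: d_def N_def)
    moreover have "card (V - N - Big) * 1 \<le> card (V - N - Big) * (d - 4)"
      using d12 by (intro mult_le_mono) auto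
    ultimately have "card A \<le> d + 5 + (?n - d) * d" using split outside by linarith
    also have "\<dots> = d * (?n - d + 1) + 5" by (simp add: algebra_simps)
    finally have "4 * card A \<le> 4 * (d * (?n - d + 1)) + 20" by simp
    also have "4 * (d * (?n - d + 1)) \<le> (d + (?n - d + 1))\<^sup>2" by (rule four_mult_le_square)
    also have "d + (?n - d + 1) = ?n + 1" using d_le by simp
    finally have "4 * card A \<le> ?n * ?n + 2 * ?n + 21" by (simp add: power2_eq_square)
    then have False using dense sq n by linarith
    then show ?thesis ..
  next
    assume "\<exists>c. \<forall>(a, b) \<in> ?E. c \<in> {a, b}"
    then obtain c where c: "\<forall>(a, b) \<in> ?E. c \<in> {a, b}" ..
    have "\<exists>h'\<in>V. h' \<noteq> h \<and> (\<forall>(a, b) \<in> ?E. h' \<in> {a, b})"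
    \<comment> \<open>If \<open>h\<close> alone covers \<open>Into v\<close>, any other vertex can
      act as the second hub; otherwise \<open>c\<close> lies on an arc avoiding \<open>h\<close> and
      so differs from \<open>h\<close>.\<close>
    proof (cases "?E = {}")
      case True
      have "\<not> V \<subseteq> {h}" using n card_mono[of "{h}" V] by auto
      then obtain h' where "h' \<in> V" "h' \<noteq> h" by auto
      then show ?thesis unfolding True by auto
    next
      case False
      then obtain a b where ab: "(a, b) \<in> ?E" by auto
      then have "c = a \<or> c = b" using bspec[OF c ab] by simp
      then have "c \<in> V" "c \<noteq> h"
        using ab by (auto simp: Into_def incident_def dest: in_arcsD1 in_arcsD2)
      then show ?thesis using c by (intro bexI[of _ c] conjI)
    qed
    then obtain h' where h': "h' \<in> V" "h' \<noteq> h" and hE: "\<forall>(a, b) \<in> ?E. h' \<in> {a, b}"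
      by (elim bexE conjE)
    define S where "S = N - {h, h'}"
    have S: "S \<subseteq> V" "finite S" using N by (auto simp: S_def)
    have "N \<subseteq> S \<union> {h, h'}" by (auto simp: S_def)
    then have "d \<le> card (S \<union> {h, h'})" unfolding d_def using S by (intro card_mono) auto
    also have "\<dots> \<le> card S + card {h, h'}" by (rule card_Un_le)
    finally have dS: "d \<le> card S + 2" using h' by simp
    have "hub_pair G S h h'"
    proof unfold_locales
      fix z w assume zw: "(z, w) \<in> A" "w \<in> S"
      then have "(z, w) \<in> Into v" by (auto simp: Into_def S_def N_def In_def)
      \<comment> \<open>The arc meets a hub, and its head lies in \<open>S\<close>, so the hub is
        its tail.\<close>
      then show "z \<in> {h, h'}" using bspec[OF hE, of "(z, w)"] zw by (auto simp: incident_def S_def)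
    next
      have "card (V - S) + card S = ?n" using S fin by (simp add: card_Diff_subset card_mono)
      then have "card S + 2 + card (V - S) = ?n + 2" by simp
      then have "4 * ((card S + 2) * card (V - S)) \<le> (?n + 2)\<^sup>2"
        using four_mult_le_square[of "card S + 2" "card (V - S)"] by simp
      then show "(card S + 2) * card (V - S) \<le> card A" using dense by linarith
    next
      fix y assume "y \<in> V"
      then show "indeg y \<le> card S + 2" using le_d[of y] dS by linarith
    next
      show "6 \<le> card S" using dS d12 by linarith
    qed (use S h h' in \<open>auto simp: S_def\<close>)
    then show ?thesis by blast
  qed
qed

end

section \<open>Extremal partitions\<close>

text \<open>The size of \<open>X\<close> is left out: given the rest, it is equivalent to the arc
  count, by \<open>card_arcs_extremal\<close> and \<open>balanced_part_iff\<close>.\<close>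

definition extremal_partition :: "'a pair_pre_digraph \<Rightarrow> 'a set \<Rightarrow> 'a set \<Rightarrow> bool" where
  "extremal_partition D X Y \<longleftrightarrow> X \<union> Y = pverts D \<and> X \<inter> Y = {} \<and>
     (\<forall>x \<in> X. \<forall>y \<in> Y. (x, y) \<in> parcs D) \<and>
     arcs (with_proj D \<restriction> X) = {} \<and> in_degree_regular 2 (with_proj D \<restriction> Y)"

context oriented_graph
begin

lemma in_degree_induced:
  assumes "y \<in> Y"
  shows "in_degree (with_proj G \<restriction> Y) y = card (In y \<inter> Y)"
proof -
  have "in_arcs (with_proj G \<restriction> Y) y = (\<lambda>x. (x, y)) ` (In y \<inter> Y)"
    using assms by (auto simp: in_arcs_def induce_subgraph_def In_def)
  then show ?thesis by (simp add: in_degree_def card_image inj_on_def)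
qed

text \<open>All arcs from \<open>X\<close> to \<open>Y\<close> are present, which rules out arcs
  back into \<open>X\<close>; so arcless \<open>X\<close> amounts to empty in-neighbourhoods in the
  whole digraph.\<close>

lemma extremal_partition_iff:
  "extremal_partition G X Y \<longleftrightarrow> X \<union> Y = V \<and> X \<inter> Y = {} \<and>
     (\<forall>x \<in> X. \<forall>y \<in> Y. (x, y) \<in> A) \<and> (\<forall>x \<in> X. In x = {}) \<and> (\<forall>y \<in> Y. card (In y \<inter> Y) = 2)"
proof -
  have reg: "in_degree_regular 2 (with_proj G \<restriction> Y) \<longleftrightarrow> (\<forall>y \<in> Y. card (In y \<inter> Y) = 2)"
    by (simp add: in_degree_regular_def in_degree_induced)
  have "arcs (with_proj G \<restriction> X) = {} \<longleftrightarrow> (\<forall>x \<in> X. In x = {})"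
    if XY: "X \<union> Y = V" "\<forall>x \<in> X. \<forall>y \<in> Y. (x, y) \<in> A"
  proof -
    have "In x \<subseteq> X" if "x \<in> X" for x
      using that XY no_opposite_arcs In_subset[of x] by (auto simp: In_iff)
    moreover have "arcs (with_proj G \<restriction> X) = {} \<longleftrightarrow> (\<forall>x \<in> X. In x \<inter> X = {})"
      by (auto simp: induce_subgraph_def In_def)
    ultimately show ?thesis by (simp add: Int_absorb2)
  qed
  then show ?thesis unfolding extremal_partition_def reg by blast
qed

lemma card_arcs_extremal:
  assumes "extremal_partition G X Y"
  shows "card A = (card X + 2) * card Y"
proof -
  have XY: "X \<union> Y = V" "X \<inter> Y = {}" "\<forall>x \<in> X. \<forall>y \<in> Y. (x, y) \<in> A" "\<forall>x \<in> X. In x = {}"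
    "\<forall>y \<in> Y. card (In y \<inter> Y) = 2"
    using assms by (auto simp: extremal_partition_iff)
  have fin: "finite X" "finite Y" using XY(1) pair_finite_verts by (metis finite_Un)+
  have "indeg y = card X + 2" if "y \<in> Y" for y
  proof -
    have "In y = X \<union> (In y \<inter> Y)" using XY that In_subset[of y] by (auto simp: In_iff)
    then have "card (In y) = card (X \<union> (In y \<inter> Y))" by simp
    also have "\<dots> = card X + card (In y \<inter> Y)" using XY fin by (intro card_Un_disjoint) auto
    finally show ?thesis using XY that by (simp add: indeg_def)
  qed
  moreover have "card A = (\<Sum>y\<in>X. indeg y) + (\<Sum>y\<in>Y. indeg y)"
    using sum.union_disjoint[OF fin XY(2), of indeg] XY(1) by (simp add: card_arcs)
  ultimately show ?thesis using XY by (simp add: indeg_def mult.commute)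
qed

text \<open>The centre and the three middle vertices of a star all receive arcs and hence lie in
  \<open>Y\<close>, where the centre has only two in-neighbours.\<close>

lemma star3_free_extremal:
  assumes "extremal_partition G X Y"
  shows "star3_free G"
proof unfold_locales
  fix w1 c w2 w3 z1 z2 z3
  assume star: "(w1, c) \<in> A" "(w2, c) \<in> A" "(w3, c) \<in> A" "(z1, w1) \<in> A" "(z2, w2) \<in> A" "(z3, w3) \<in> A"
    "distinct [w1, w2, w3, z1, z2, z3]"
  have XY: "X \<union> Y = V" "\<forall>x \<in> X. In x = {}" "\<forall>y \<in> Y. card (In y \<inter> Y) = 2"
    using assms by (auto simp: extremal_partition_iff)
  have head_Y: "y \<in> Y" if "(x, y) \<in> A" for x y
    using that XY(1,2) in_arcsD2[OF that] by (auto simp: In_def)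
  have "{w1, w2, w3} \<subseteq> In c \<inter> Y" using star head_Y by (auto simp: In_def)
  then have "card {w1, w2, w3} \<le> card (In c \<inter> Y)" by (intro card_mono) auto
  then show False using star XY(3) head_Y[OF star(1)] by simp
qed

end

lemma (in star3_free) extremal_partition_exists:
  assumes "40 \<le> card V" "(card V + 2)\<^sup>2 \<le> 4 * card A + 1"
  shows "\<exists>X Y. extremal_partition G X Y"
proof -
  obtain S h h' where "hub_pair G S h h'" using hub_pair_exists assms by blast
  then interpret hub_pair G S h h' .
  have "extremal_partition G S R"
    using extremal_structure S_subset by (auto simp: extremal_partition_iff R_def)
  then show ?thesis by blast
qed

section \<open>The oriented Turan number\<close>

lemma star3_arcs:
  "parcs (subdivided_in_star 3) = {(Leaf 1, Mid 1), (Leaf 2, Mid 2), (Leaf 3, Mid 3),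
     (Mid 1, Center), (Mid 2, Center), (Mid 3, Center)}"
proof -
  have "{1..3} = {1, 2, 3::nat}" by auto
  then show ?thesis by (auto simp: subdivided_in_star_def)
qed

lemma star3_verts:
  "pverts (subdivided_in_star 3) = {Center, Mid 1, Mid 2, Mid 3, Leaf 1, Leaf 2, Leaf 3}"
proof -
  have "{1..3} = {1, 2, 3::nat}" by auto
  then show ?thesis by (auto simp: subdivided_in_star_def)
qed

context oriented_graph
begin

lemma star3_free_imp_digraph_free:
  assumes "star3_free G"
  shows "digraph_free (subdivided_in_star 3) G"
  unfolding digraph_free_def
proof
  let ?F = "with_proj (subdivided_in_star 3)"
  assume "\<exists>H :: 'a pair_pre_digraph. subgraph (with_proj H) (with_proj G) \<and> digraph_iso ?F (with_proj H)"
  then obtain H :: "'a pair_pre_digraph" and f where sub: "parcs H \<subseteq> A"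
    and f: "pre_digraph.digraph_isomorphism ?F f" and H: "with_proj H = app_iso f ?F"
    by (auto simp: subgraph_def digraph_iso_def)
  let ?g = "iso_verts f"
  have inj: "inj_on ?g (pverts (subdivided_in_star 3))"
    using pre_digraph.digraph_isomorphism_inj_on_verts[OF f] by simp
  \<comment> \<open>An isomorphism brings its own tail and head maps; those of
    \<open>with_proj H\<close> are the projections, so arcs go to the pairs of the images of their
    ends.\<close>
  have ends: "tail (with_proj H) = iso_tail f" "head (with_proj H) = iso_head f" by (simp_all only: H app_iso_simps)
  have arc: "(?g x, ?g y) \<in> A" if "(x, y) \<in> parcs (subdivided_in_star 3)" for x y
  proof -
    have xy: "(x, y) \<in> arcs ?F" using that by simp
    have "iso_arcs f (x, y) \<in> arcs (with_proj H)" unfolding H using xy by simp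
    moreover have "fst (iso_arcs f (x, y)) = ?g x" "snd (iso_arcs f (x, y)) = ?g y"
      using pre_digraph.iso_verts_tail[OF f xy] pre_digraph.iso_verts_head[OF f xy] ends by simp_all
    ultimately show ?thesis using sub by (metis prod.collapse subsetD with_proj_simps(2))
  qed
  show False
    by (rule star3_free.no_star[OF assms, of "?g (Mid 1)" "?g Center" "?g (Mid 2)" "?g (Mid 3)"
          "?g (Leaf 1)" "?g (Leaf 2)" "?g (Leaf 3)"])
      (use arc inj in \<open>auto simp: star3_arcs star3_verts inj_on_def\<close>)
qed

lemma digraph_free_imp_star3_free:
  assumes free: "digraph_free (subdivided_in_star 3) G"
  shows "star3_free G"
proof unfold_locales
  fix w1 c w2 w3 z1 z2 z3
  assume star: "(w1, c) \<in> A" "(w2, c) \<in> A" "(w3, c) \<in> A" "(z1, w1) \<in> A" "(z2, w2) \<in> A" "(z3, w3) \<in> A"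
    "distinct [w1, w2, w3, z1, z2, z3]"
  have c: "c \<notin> {w1, w2, w3, z1, z2, z3}"
    using star(1-6) not_loop no_opposite_arcs by blast
  let ?F = "with_proj (subdivided_in_star 3)"
  \<comment> \<open>The final \<open>else\<close> branches stand for index 3, the only other index
    in the vertex set.\<close>
  define g where "g = (\<lambda>x. case x of Center \<Rightarrow> c
    | Mid i \<Rightarrow> if i = 1 then w1 else if i = 2 then w2 else w3
    | Leaf i \<Rightarrow> if i = 1 then z1 else if i = 2 then z2 else z3)"
  define f where "f = \<lparr>iso_verts = g, iso_arcs = map_prod g g, iso_head = snd, iso_tail = fst\<rparr>"
  define H where "H = \<lparr>pverts = g ` pverts (subdivided_in_star 3),
    parcs = map_prod g g ` parcs (subdivided_in_star 3)\<rparr>"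
  have inj: "inj_on g (pverts (subdivided_in_star 3))"
    using star(7) c by (auto simp: inj_on_def star3_verts g_def)
  have wf: "wf_digraph ?F"
    by unfold_locales (auto simp: star3_arcs star3_verts)
  have arcs_sub: "parcs (subdivided_in_star 3) \<subseteq>
      pverts (subdivided_in_star 3) \<times> pverts (subdivided_in_star 3)"
    by (auto simp: star3_arcs star3_verts)
  have "inj_on (map_prod g g) (parcs (subdivided_in_star 3))"
    using map_prod_inj_on[OF inj inj] arcs_sub by (rule inj_on_subset)
  then have "pre_digraph.digraph_isomorphism ?F f"
    unfolding pre_digraph.digraph_isomorphism_def using wf inj by (auto simp: f_def)
  moreover have "with_proj H = app_iso f ?F"
    by (simp add: with_proj_def H_def app_iso_def f_def)
  ultimately have iso: "digraph_iso ?F (with_proj H)" unfolding digraph_iso_def by blast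
  have arcs: "parcs H \<subseteq> A" using star by (auto simp: H_def star3_arcs g_def)
  moreover have verts: "pverts H \<subseteq> V"
    using star(1-6) in_arcsD1 in_arcsD2 by (auto simp: H_def star3_verts g_def)
  moreover have "wf_digraph (with_proj H)"
    using arcs_sub by unfold_locales (auto simp: H_def)
  ultimately have "subgraph (with_proj H) (with_proj G)"
    using wf_digraph_axioms by (auto simp: subgraph_def compatible_def)
  then show False using free iso unfolding digraph_free_def by blast
qed

lemma digraph_free_iff: "digraph_free (subdivided_in_star 3) G \<longleftrightarrow> star3_free G"
  using star3_free_imp_digraph_free digraph_free_imp_star3_free by blast

lemma extremal_partition_card:
  assumes "extremal_partition G X Y"
  shows "card X + card Y = card V"
proof -
  have "X \<union> Y = V" "X \<inter> Y = {}" using assms by (auto simp: extremal_partition_iff)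
  moreover have "finite X" "finite Y" using calculation pair_finite_verts by (metis finite_Un)+
  ultimately show ?thesis using card_Un_disjoint by metis
qed

end

section \<open>Arithmetic of the bound\<close>

lemma four_times_div_four:
  fixes n :: nat
  shows "4 * ((n + 2)\<^sup>2 div 4) = (if even n then (n + 2)\<^sup>2 else (n + 2)\<^sup>2 - 1)"
proof (cases "even n")
  case True
  then obtain m where "n = 2 * m" by auto
  then have "(n + 2)\<^sup>2 = 4 * (m + 1)\<^sup>2" by (simp add: power2_eq_square)
  then show ?thesis using True by simp
next
  case False
  then obtain m where "n = 2 * m + 1" by (auto elim: oddE)
  then have "(n + 2)\<^sup>2 = 4 * (m * m + 3 * m + 2) + 1" by (simp add: power2_eq_square)
  then have "(n + 2)\<^sup>2 mod 4 = 1" by presburger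
  then show ?thesis using False div_mult_mod_eq[of "(n + 2)\<^sup>2" 4] by simp
qed

lemma floor_square_div_four: "\<lfloor>(real n + 2)\<^sup>2 / 4\<rfloor> = int ((n + 2)\<^sup>2 div 4)"
proof -
  have "(real n + 2)\<^sup>2 / 4 = real ((n + 2)\<^sup>2) / real 4" by simp
  then show ?thesis by (simp only: floor_divide_of_nat_eq)
qed

text \<open>Four times the product differs from \<open>(n + 2)\<^sup>2\<close> by the square of
  \<open>s + 2 - r\<close>. The maximum is attained when this difference is 0 for even
  \<open>n\<close>, and 1 or -1 for odd \<open>n\<close>.\<close>

lemma balanced_part_iff:
  fixes s r n :: nat
  assumes "s + r = n" "40 \<le> n"
  shows "(s + 2) * r = (n + 2)\<^sup>2 div 4 \<longleftrightarrow>
    int s \<in> {\<lfloor>real n / 2\<rfloor> - 1, \<lceil>real n / 2\<rceil> - 1}"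
proof -
  have id: "int ((n + 2)\<^sup>2) = 4 * int ((s + 2) * r) + (int s + 2 - int r)\<^sup>2"
    by (simp add: assms(1)[symmetric] power2_eq_square algebra_simps)
  show ?thesis
  proof (cases "even n")
    case True
    then obtain m where m: "n = 2 * m" by auto
    have "(s + 2) * r = (n + 2)\<^sup>2 div 4 \<longleftrightarrow> 4 * ((s + 2) * r) = (n + 2)\<^sup>2"
      using four_times_div_four[of n] True by auto
    also have "\<dots> \<longleftrightarrow> (int s + 2 - int r)\<^sup>2 = 0" using id by linarith
    also have "\<dots> \<longleftrightarrow> int s = int m - 1" using assms m by auto
    finally show ?thesis using m by simp
  next
    case False
    then obtain m where m: "n = 2 * m + 1" by (auto elim: oddE)
    have "4 * ((n + 2)\<^sup>2 div 4) + 1 = (n + 2)\<^sup>2" using four_times_div_four[of n] False by simp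
    then have "(s + 2) * r = (n + 2)\<^sup>2 div 4 \<longleftrightarrow> 4 * ((s + 2) * r) + 1 = (n + 2)\<^sup>2" by linarith
    also have "\<dots> \<longleftrightarrow> (int s + 2 - int r)\<^sup>2 = 1" using id by linarith
    also have "\<dots> \<longleftrightarrow> int s = int m - 1 \<or> int s = int m"
      using assms m by (auto simp: power2_eq_1_iff)
    also have "\<lfloor>real n / 2\<rfloor> = int m" using m by linarith
    moreover have "\<lceil>real n / 2\<rceil> = int m + 1" using m by linarith
    ultimately show ?thesis by auto
  qed
qed

section \<open>Upper bound, construction and the main result\<close>

lemma card_arcs_star3_free_le:
  assumes "star3_free D" "40 \<le> card (pverts D)"
  shows "card (parcs D) \<le> (card (pverts D) + 2)\<^sup>2 div 4"
proof (rule ccontr)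
  interpret star3_free D by fact
  assume "\<not> ?thesis"
  then have less: "(card V + 2)\<^sup>2 div 4 < card A" by simp
  then have "(card V + 2)\<^sup>2 \<le> 4 * card A + 1" by linarith
  \<comment> \<open>Too many arcs are in particular enough for an extremal partition, whose arc
    count is a product with factors adding up to \<open>card V + 2\<close>.\<close>
  then obtain X Y where XY: "extremal_partition D X Y"
    using extremal_partition_exists assms by blast
  have "4 * card A \<le> (card X + 2 + card Y)\<^sup>2"
    using four_mult_le_square[of "card X + 2" "card Y"] card_arcs_extremal[OF XY] by simp
  also have "card X + 2 + card Y = card V + 2" using extremal_partition_card[OF XY] by simp
  finally show False using less by linarith
qed

lemma exists_extremal:
  assumes "40 \<le> n"
  shows "\<exists>D :: nat pair_pre_digraph. oriented_graph D \<and> card (pverts D) = n \<and>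
    star3_free D \<and> card (parcs D) = (n + 2)\<^sup>2 div 4"
proof -
  define a where "a = n div 2 - 1"
  \<comment> \<open>At least five vertices remain for \<open>Y\<close>, so that cyclic steps by one
    and two never give opposite arcs.\<close>
  have a: "a + 5 \<le> n" using assms by (simp add: a_def)
  \<comment> \<open>The circulant digraph on \<open>{a..<n}\<close> in which each vertex sends arcs
    to its next two cyclic successors; the last three alternatives are the arcs that wrap
    around.\<close>
  define C where "C = {(x, y). a \<le> x \<and> x < n \<and> a \<le> y \<and> y < n \<and> (y = x + 1 \<or> y = x + 2 \<or>
    y = a \<and> x + 2 = n \<or> y = a \<and> x + 1 = n \<or> y = a + 1 \<and> x + 1 = n)}"
  define D where "D = \<lparr>pverts = {..<n}, parcs = {..<a} \<times> {a..<n} \<union> C\<rparr>"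
  have C_in: "{x. (x, y) \<in> C} =
      (if y = a then {n - 2, n - 1} else if y = a + 1 then {n - 1, a} else {y - 2, y - 1})"
    if "a \<le> y" "y < n" for y
    using that a by (auto simp: C_def)
  have C_sub: "C \<subseteq> {a..<n} \<times> {a..<n}" by (auto simp: C_def)
  have D: "oriented_graph D"
  proof unfold_locales
    show "finite (parcs D)"
      using C_sub finite_subset by (auto simp: D_def)
    show "fst e \<noteq> snd e" if "e \<in> parcs D" for e
      using that a by (auto simp: D_def C_def)
    show "(v, u) \<notin> parcs D" if "(u, v) \<in> parcs D" for u v
      using that a by (auto simp: D_def C_def)
  qed (use a in \<open>auto simp: D_def C_def\<close>)
  then interpret oriented_graph D .
  have "extremal_partition D {..<a} {a..<n}"
    unfolding extremal_partition_iff
  proof (intro conjI ballI)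
    fix y assume y: "y \<in> {a..<n}"
    have "In y \<inter> {a..<n} = {x. (x, y) \<in> C}"
      using y C_sub unfolding In_def by (auto simp: D_def)
    then show "card (In y \<inter> {a..<n}) = 2" using y a C_in[of y] by auto
  next
    fix x assume "x \<in> {..<a}"
    then show "In x = {}" using C_sub unfolding In_def by (auto simp: D_def)
  qed (use a in \<open>auto simp: D_def\<close>)
  moreover have "(a + 2) * (n - a) = (n + 2)\<^sup>2 div 4"
  proof (subst balanced_part_iff)
    have "\<lfloor>real n / 2\<rfloor> = int (n div 2)" using floor_divide_of_nat_eq[of n 2] by simp
    then show "int a \<in> {\<lfloor>real n / 2\<rfloor> - 1, \<lceil>real n / 2\<rceil> - 1}" using assms by (simp add: a_def of_nat_diff)
  qed (use a assms in auto)
  ultimately have "star3_free D \<and> card (parcs D) = (n + 2)\<^sup>2 div 4"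
    using star3_free_extremal card_arcs_extremal by fastforce
  then show ?thesis using D by (intro exI[of _ D]) (simp add: D_def)
qed

lemma ex_ori_star3:
  assumes "40 \<le> n"
  shows "ex_ori n (subdivided_in_star 3) = (n + 2)\<^sup>2 div 4"
  unfolding ex_ori_def
proof (rule Max_eqI)
  let ?M = "{card (parcs D) | D :: nat pair_pre_digraph. oriented_graph D \<and> card (pverts D) = n \<and>
    digraph_free (subdivided_in_star 3) D}"
  show le: "m \<le> (n + 2)\<^sup>2 div 4" if "m \<in> ?M" for m
    using that card_arcs_star3_free_le oriented_graph.digraph_free_iff assms by blast
  show "finite ?M" using le by (intro finite_subset[of ?M "{..(n + 2)\<^sup>2 div 4}"]) auto
  obtain D :: "nat pair_pre_digraph" where D: "oriented_graph D" "card (pverts D) = n" "star3_free D"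
    "card (parcs D) = (n + 2)\<^sup>2 div 4"
    using exists_extremal[OF assms] by blast
  then have "digraph_free (subdivided_in_star 3) D" using oriented_graph.digraph_free_iff by blast
  then show "(n + 2)\<^sup>2 div 4 \<in> ?M"
    by (intro CollectI exI[of _ D]) (simp add: D)
qed

theorem theorem1p2:
  fixes n :: nat
  assumes "n \<ge> 40"
  shows "int (ex_ori n (subdivided_in_star 3)) = \<lfloor>(real n + 2)^2 / 4\<rfloor> \<and>
    (\<forall>D :: 'a pair_pre_digraph. oriented_graph D \<and> card (pverts D) = n \<longrightarrow>
       (digraph_free (subdivided_in_star 3) D \<and>
          card (parcs D) = ex_ori n (subdivided_in_star 3)
        \<longleftrightarrow>
        (\<exists>X Y. X \<union> Y = pverts D \<and> X \<inter> Y = {} \<and>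
           int (card X) \<in> {\<lfloor>real n / 2\<rfloor> - 1, \<lceil>real n / 2\<rceil> - 1} \<and>
           (\<forall>x \<in> X. \<forall>y \<in> Y. (x, y) \<in> parcs D) \<and>
           arcs (with_proj D \<restriction> X) = {} \<and>
           in_degree_regular 2 (with_proj D \<restriction> Y))))"
proof (intro conjI allI impI)
  show "int (ex_ori n (subdivided_in_star 3)) = \<lfloor>(real n + 2)^2 / 4\<rfloor>"
    by (simp only: ex_ori_star3[OF assms] floor_square_div_four)
next
  fix D :: "'a pair_pre_digraph"
  assume D: "oriented_graph D \<and> card (pverts D) = n"
  then interpret oriented_graph D by simp
  have n: "card V = n" using D by simp
  \<comment> \<open>This trades the size of \<open>X\<close> for the arc count, so only the
    existence of a partition remains to be shown.\<close>
  have card_iff: "card A = (n + 2)\<^sup>2 div 4 \<longleftrightarrow>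
      int (card X) \<in> {\<lfloor>real n / 2\<rfloor> - 1, \<lceil>real n / 2\<rceil> - 1}" if "extremal_partition D X Y" for X Y
    using balanced_part_iff[of "card X" "card Y" n] extremal_partition_card[OF that]
      card_arcs_extremal[OF that] n assms by simp
  have "star3_free D \<and> card A = (n + 2)\<^sup>2 div 4 \<longleftrightarrow>
      (\<exists>X Y. extremal_partition D X Y \<and> int (card X) \<in> {\<lfloor>real n / 2\<rfloor> - 1, \<lceil>real n / 2\<rceil> - 1})"
    (is "?L \<longleftrightarrow> ?R")
  proof
    assume L: ?L
    then have "(card V + 2)\<^sup>2 \<le> 4 * card A + 1"
      using four_times_div_four[of n] n by (auto split: if_splits)
    then obtain X Y where "extremal_partition D X Y"
      using star3_free.extremal_partition_exists[of D] L n assms by blast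
    then show ?R using L card_iff by blast
  next
    assume ?R
    then show ?L using card_iff star3_free_extremal by blast
  qed
  then show "digraph_free (subdivided_in_star 3) D \<and>
          card (parcs D) = ex_ori n (subdivided_in_star 3)
        \<longleftrightarrow>
        (\<exists>X Y. X \<union> Y = pverts D \<and> X \<inter> Y = {} \<and>
           int (card X) \<in> {\<lfloor>real n / 2\<rfloor> - 1, \<lceil>real n / 2\<rceil> - 1} \<and>
           (\<forall>x \<in> X. \<forall>y \<in> Y. (x, y) \<in> parcs D) \<and>
           arcs (with_proj D \<restriction> X) = {} \<and>
           in_degree_regular 2 (with_proj D \<restriction> Y))"
    unfolding digraph_free_iff ex_ori_star3[OF assms] extremal_partition_def
    by (simp only: conj_ac)
qed

end
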